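(* Consider the elastic net hyperparameter problem with training data $A_{tr}\in\mathbb R^{m\times n}$, $\mathbf b_{tr}\in\mathbb R^m$ and validation data $A_{val},\mathbf b_{val}$: $$\min_{\mathbf x,\boldsymbol\lambda\ge0}\ L(\mathbf x)=\tfrac12\|A_{val}\mathbf x-\mathbf b_{val}\|_2^2\quad\text{s.t.}\quad \mathbf x\in\operatorname*{arg\,min}_{\hat{\mathbf x}\in\mathbb R^n}\ \tfrac12\|A_{tr}\hat{\mathbf x}-\mathbf b_{tr}\|_2^2+\lambda_1\|\hat{\mathbf x}\|_1+\tfrac{\lambda_2}{2}\|\hat{\mathbf x}\|_2^2 .$$ Suppose $A_{tr}$ has full row rank. Let $(\boldsymbol\lambda^k,\mathbf r^k)\in\mathbb R^2\times\mathbb R^2$ and let the function $m(\cdot,\cdot;\bar\xi,\bar\zeta)$ be either $$m(\xi,\zeta;\bar\xi,\bar\zeta)=\tfrac12\Big(\tfrac{\bar\xi}{\bar\zeta}\zeta^2+\tfrac{\bar\zeta}{\bar\xi}\xi^2\Big)\quad(\text{used when } \bar\xi,\bar\zeta>0,\text{ i.e. } \boldsymbol\lambda^k,\mathbf r^k>0)$$ or $$m(\xi,\zeta;\bar\xi,\bar\zeta)=\tfrac14(\xi+\zeta)^2+\tfrac14(\bar\xi-\bar\zeta)^2-\tfrac12(\bar\xi-\bar\zeta)(\xi-\zeta).$$ Then the subproblem $$\begin{array}{cl}\displaystyle\min_{\mathbf x,\boldsymbol\lambda,\boldsymbol\rho,\mathbf r}& L(\mathbf x)\\ \text{s.t.}&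 F(\mathbf x,\boldsymbol\lambda,\boldsymbol\rho)+\sum_{i=1}^2m(\lambda_i,r_i;\lambda_i^k,r_i^k)\le0,\\ & \|\mathbf x\|_1\le r_1,\quad \tfrac12\|\mathbf x\|_2^2\le r_2,\quad \boldsymbol\lambda\ge0\end{array}$$ can be reformulated into a conic program of the form $$\begin{array}{cl}\min & t\\ \text{s.t.}& A_{tr}^T\mathbf w+\boldsymbol\rho_1+\boldsymbol\rho_2=\mathbf 0,\\ & \|\mathbf x\|_1\le r_1,\quad \|\boldsymbol\rho_1\|_\infty\le\lambda_1,\\ & \mathrm{SOCs}(\mathbf x,\boldsymbol\lambda,\boldsymbol\rho,\mathbf r,t),\end{array}$$ where $\mathrm{SOCs}(\mathbf x,\boldsymbol\lambda,\boldsymbol\rho,\mathbf r,t)$ represents (finitely many) second-order cone constraints.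
   Context: Here $\mathbf x,\boldsymbol\rho_1,\boldsymbol\rho_2\in\mathbb R^n$, $\boldsymbol\lambda,\mathbf r\in\mathbb R^2$, $\mathbf w\in\mathbb R^m$, $t\in\mathbb R$, and $\boldsymbol\rho=(\boldsymbol\rho_1,\boldsymbol\rho_2)$. (The letter $m$ denotes the row dimension of $A_{tr}$ when used as a dimension, and the function above when written with arguments.) With $l(\mathbf x)=\frac12\|A_{tr}\mathbf x-\mathbf b_{tr}\|_2^2$, $P_1=\|\cdot\|_1$, $P_2=\frac12\|\cdot\|_2^2$, $$F(\mathbf x,\boldsymbol\lambda,\boldsymbol\rho)=l(\mathbf x)+l^*(-\boldsymbol\rho_1-\boldsymbol\rho_2)+\sum_{i=1}^2\lambda_iP_i^*(\boldsymbol\rho_i/\lambda_i),$$ where $^*$ is the Fenchel conjugate, and for $\lambda_i=0$ the term $\lambda_iP_i^*(\boldsymbol\rho_i/\lambda_i)$ equals $0$ if $\boldsymbol\rho_i=\mathbf 0$ and $+\infty$ otherwise. A second-order cone constraint is one of the form $\|Mu+q\|_2\le c^Tu+d$ in the vector $u$ of decision variables; besides $(\mathbf x,\boldsymbol\lambda,\boldsymbol\rho,\mathbf r,t)$ the constraints may involve $\mathbf w$ and finitely many auxiliary scalar variables. "Reformulated" means: $(\mathbf x,\boldsymbol\lambda,\boldsymbol\rho,\mathbf r)$ is feasible for the subproblem and $L(\mathbf x)\le t$ if and only if there exist $\mathbf w$ and values of the auxiliary variables satisfying all constraints of the conic program. *)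

theory Defs
  imports "HOL-Analysis.Analysis"
begin

definition fenchel_conjugate :: "('a::real_inner \<Rightarrow> real) \<Rightarrow> 'a \<Rightarrow> ereal" where
  "fenchel_conjugate f y = (SUP x. ereal (y \<bullet> x - f x))"

definition l1norm :: "real ^ 'n \<Rightarrow> real" where
  "l1norm x = (\<Sum>j\<in>UNIV. \<bar>x $ j\<bar>)"

definition lsq :: "real ^ 'n ^ 'k \<Rightarrow> real ^ 'k \<Rightarrow> real ^ 'n \<Rightarrow> real" where
  "lsq A b x = 1/2 * (norm (A *v x - b))\<^sup>2"

text \<open>The pair of regularizers, indexed by the two-element type \<open>2\<close> (whose elements are \<open>1\<close> and
  \<open>2 = 0\<close>); a vector in \<open>real ^ 2\<close> has the components \<open>$ 1\<close> and \<open>$ 2\<close>.\<close>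

definition regularizer :: "2 \<Rightarrow> real ^ 'n \<Rightarrow> real" where
  "regularizer i x = (if i = 1 then l1norm x else 1/2 * (norm x)\<^sup>2)"

text \<open>\<open>l P\<^sup>*(y / l)\<close> with its closure at \<open>l = 0\<close>. Negative \<open>l\<close> carries no meaning and is excluded
  by the constraint \<open>0 \<le> lam\<close> of the subproblem.\<close>

definition conjugate_perspective ::
  "('a::real_inner \<Rightarrow> real) \<Rightarrow> real \<Rightarrow> 'a \<Rightarrow> ereal" where
  "conjugate_perspective P l y =
     (if l = 0 then (if y = 0 then 0 else \<infinity>) else ereal l * fenchel_conjugate P (y /\<^sub>R l))"

text \<open>The two multipliers \<open>\<rho>\<^sub>1, \<rho>\<^sub>2\<close> are the components of \<open>\<rho> :: (real ^ 'n) ^ 2\<close>.\<close>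

definition penalty_F ::
  "real ^ 'n ^ 'm \<Rightarrow> real ^ 'm \<Rightarrow> real ^ 'n \<Rightarrow> real ^ 2 \<Rightarrow> real ^ 'n ^ 2 \<Rightarrow> ereal" where
  "penalty_F A b x lam \<rho> =
     ereal (lsq A b x) + fenchel_conjugate (lsq A b) (- (\<rho> $ 1) - \<rho> $ 2)
     + (\<Sum>i\<in>UNIV. conjugate_perspective (regularizer i) (lam $ i) (\<rho> $ i))"

text \<open>Convex majorants of the product \<open>\<xi> * \<zeta>\<close> at the point \<open>(\<xi>', \<zeta>')\<close>, in the argument order
  \<open>\<xi> \<zeta> \<xi>' \<zeta>'\<close>; the first one requires \<open>\<xi>', \<zeta>' > 0\<close>.\<close>

definition majorant_scaled :: "real \<Rightarrow> real \<Rightarrow> real \<Rightarrow> real \<Rightarrow> real" where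
  "majorant_scaled \<xi> \<zeta> \<xi>' \<zeta>' = 1/2 * (\<xi>' / \<zeta>' * \<zeta>\<^sup>2 + \<zeta>' / \<xi>' * \<xi>\<^sup>2)"

definition majorant_dc :: "real \<Rightarrow> real \<Rightarrow> real \<Rightarrow> real \<Rightarrow> real" where
  "majorant_dc \<xi> \<zeta> \<xi>' \<zeta>' =
     1/4 * (\<xi> + \<zeta>)\<^sup>2 + 1/4 * (\<xi>' - \<zeta>')\<^sup>2 - 1/2 * (\<xi>' - \<zeta>') * (\<xi> - \<zeta>)"

definition subproblem_feasible ::
  "real ^ 'n ^ 'm \<Rightarrow> real ^ 'm \<Rightarrow> (real \<Rightarrow> real \<Rightarrow> real \<Rightarrow> real \<Rightarrow> real) \<Rightarrow> real ^ 2 \<Rightarrow> real ^ 2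
    \<Rightarrow> real ^ 'n \<Rightarrow> real ^ 2 \<Rightarrow> real ^ 'n ^ 2 \<Rightarrow> real ^ 2 \<Rightarrow> bool" where
  "subproblem_feasible A b mj lamk rk x lam \<rho> r \<longleftrightarrow>
     penalty_F A b x lam \<rho> + ereal (\<Sum>i\<in>UNIV. mj (lam $ i) (r $ i) (lamk $ i) (rk $ i)) \<le> 0 \<and>
     l1norm x \<le> r $ 1 \<and> 1/2 * (norm x)\<^sup>2 \<le> r $ 2 \<and> (\<forall>i. 0 \<le> lam $ i)"

text \<open>Names of the scalar decision variables of the conic program. The number \<open>p\<close> of auxiliary
  variables is existentially quantified in the theorem and so cannot be the dimension of a type;
  the decision vector is therefore a function on the finite set \<open>vars p\<close> of names.\<close>

datatype ('n, 'm) var =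
  VarX 'n | VarLam 2 | VarRho 2 'n | VarR 2 | VarT | VarW 'm | VarAux nat

definition vars :: "nat \<Rightarrow> ('n, 'm) var set" where
  "vars p = range VarX \<union> range VarLam \<union> range (\<lambda>(i, j). VarRho i j) \<union> range VarR \<union> {VarT}
     \<union> range VarW \<union> VarAux ` {..<p}"

lemma finite_vars: "finite (vars p :: ('n::finite, 'm::finite) var set)"
  by (simp add: vars_def)

lemma mem_vars_iff: "v \<in> vars p \<longleftrightarrow> (\<forall>k. v = VarAux k \<longrightarrow> k < p)"
  by (cases v) (auto simp: vars_def)

fun decision_vector ::
  "real ^ 'n \<Rightarrow> real ^ 2 \<Rightarrow> real ^ 'n ^ 2 \<Rightarrow> real ^ 2 \<Rightarrow> real \<Rightarrow> real ^ 'm \<Rightarrow> (nat \<Rightarrow> real)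
    \<Rightarrow> ('n, 'm) var \<Rightarrow> real" where
  "decision_vector x lam \<rho> r t w s (VarX j) = x $ j"
| "decision_vector x lam \<rho> r t w s (VarLam i) = lam $ i"
| "decision_vector x lam \<rho> r t w s (VarRho i j) = \<rho> $ i $ j"
| "decision_vector x lam \<rho> r t w s (VarR i) = r $ i"
| "decision_vector x lam \<rho> r t w s VarT = t"
| "decision_vector x lam \<rho> r t w s (VarW j) = w $ j"
| "decision_vector x lam \<rho> r t w s (VarAux k) = s k"

text \<open>\<open>SOC k M q c d\<close> is the constraint \<open>\<parallel>M u + q\<parallel>\<^sub>2 \<le> c\<^sup>T u + d\<close>, where \<open>M\<close> has \<open>k\<close> rows and its
  columns, like the entries of \<open>c\<close>, are indexed by variable names. Coefficients outside
  \<open>{..<k}\<close> and \<open>vars p\<close> are ignored.\<close>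

datatype ('n, 'm) soc =
  SOC nat "nat \<Rightarrow> ('n, 'm) var \<Rightarrow> real" "nat \<Rightarrow> real" "('n, 'm) var \<Rightarrow> real" real

fun soc_holds :: "nat \<Rightarrow> (('n::finite, 'm::finite) var \<Rightarrow> real) \<Rightarrow> ('n, 'm) soc \<Rightarrow> bool" where
  "soc_holds p u (SOC k M q c d) \<longleftrightarrow>
     L2_set (\<lambda>i. (\<Sum>v\<in>vars p. M i v * u v) + q i) {..<k} \<le> (\<Sum>v\<in>vars p. c v * u v) + d"

end

theory Submission imports Defs begin

text \<open>The penalty \<open>F\<close> is second-order cone representable because each conjugate in it has a closed
  form. The conjugate of the loss is finite only on the range of \<open>A\<^sup>T\<close>; on
  \<open>A\<^sup>T w = - \<rho>\<^sub>1 - \<rho>\<^sub>2\<close> it equals \<open>1/2 \<parallel>w\<parallel>\<^sup>2 + w\<^sup>T b\<close>, and full row rank makes this value attained.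
  This gives the linear equation and the variable \<open>w\<close>. The conjugate of the 1-norm is the indicator
  of the unit ball of the maximum norm, so that its perspective is the bound on \<open>\<parallel>\<rho>\<^sub>1\<parallel>\<^sub>\<infinity>\<close>. Half the
  squared norm is its own conjugate, so that its perspective is \<open>\<parallel>\<rho>\<^sub>2\<parallel>\<^sup>2 / (2 \<lambda>\<^sub>2)\<close>. This
  fraction is bounded by one auxiliary scalar \<open>s\<close> through the rotated cone
  \<open>\<parallel>\<rho>\<^sub>2\<parallel>\<^sup>2 \<le> 2 \<lambda>\<^sub>2 s\<close>, which also gives the right value at \<open>\<lambda>\<^sub>2 = 0\<close>.
  All this is \<open>penalty_constraint_iff\<close>.

  What remains are inequalities \<open>1/2 q \<le> g\<close> with \<open>q\<close> a sum of squares of affine functions and \<open>g\<close>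
  affine: the two majorants are of the form \<open>1/2 q + l\<close> as well. Such inequalities
  are cone constraints by \<open>soc_convex_quadratic\<close>, which together with \<open>soc_rotated_cone\<close> yields
  four cones in total.\<close>

section \<open>Convex quadratic inequalities as second-order cone constraints\<close>

text \<open>Affine functions are handled as functions of the decision vector, so that the coefficients
  of a cone never have to be written down: they exist by the closure rules below.\<close>

definition affine_form :: "nat \<Rightarrow> ((('n::finite, 'm::finite) var \<Rightarrow> real) \<Rightarrow> real) \<Rightarrow> bool" where
  "affine_form p f \<longleftrightarrow> (\<exists>c d. \<forall>u. f u = (\<Sum>v\<in>vars p. c v * u v) + d)"

text \<open>These are the squared left-hand sides of cone constraints. A list is used because addition then
  is concatenation, and a summand may occur twice.\<close>

definition sum_of_affine_squares ::
  "nat \<Rightarrow> ((('n::finite, 'm::finite) var \<Rightarrow> real) \<Rightarrow> real) \<Rightarrow> bool" where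
  "sum_of_affine_squares p q \<longleftrightarrow>
     (\<exists>fs. (\<forall>f\<in>set fs. affine_form p f) \<and> (\<forall>u. q u = (\<Sum>f\<leftarrow>fs. (f u)\<^sup>2)))"

lemma affine_formI: "(\<And>u. f u = (\<Sum>v\<in>vars p. c v * u v) + d) \<Longrightarrow> affine_form p f"
  unfolding affine_form_def by blast

lemma affine_form_const: "affine_form p (\<lambda>u. d)"
  by (rule affine_formI[where c = "\<lambda>v. 0"]) simp

lemma affine_form_var:
  assumes "v \<in> vars p"
  shows "affine_form p (\<lambda>u. u v)"
  by (rule affine_formI[where c = "\<lambda>v'. if v' = v then 1 else 0" and d = 0])
     (use assms in \<open>simp add: finite_vars if_distrib[of "\<lambda>a. a * _"] cong: if_cong\<close>)

lemma affine_form_add: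
  assumes "affine_form p f" "affine_form p g"
  shows "affine_form p (\<lambda>u. f u + g u)"
proof -
  obtain c d where f: "\<And>u. f u = (\<Sum>v\<in>vars p. c v * u v) + d"
    using assms(1) unfolding affine_form_def by blast
  obtain c' d' where g: "\<And>u. g u = (\<Sum>v\<in>vars p. c' v * u v) + d'"
    using assms(2) unfolding affine_form_def by blast
  show ?thesis
    by (rule affine_formI[where c = "\<lambda>v. c v + c' v" and d = "d + d'"])
       (simp add: f g sum.distrib algebra_simps)
qed

lemma affine_form_scale:
  assumes "affine_form p f"
  shows "affine_form p (\<lambda>u. a * f u)"
proof -
  obtain c d where f: "\<And>u. f u = (\<Sum>v\<in>vars p. c v * u v) + d"
    using assms unfolding affine_form_def by blast
  show ?thesis
    by (rule affine_formI[where c = "\<lambda>v. a * c v" and d = "a * d"])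
       (simp add: f sum_distrib_left algebra_simps)
qed

lemma affine_form_diff:
  assumes "affine_form p f" "affine_form p g"
  shows "affine_form p (\<lambda>u. f u - g u)"
  using affine_form_add[OF assms(1) affine_form_scale[OF assms(2), of "-1"]] by simp

lemma affine_form_sum:
  assumes "\<And>i. i \<in> I \<Longrightarrow> affine_form p (f i)"
  shows "affine_form p (\<lambda>u. \<Sum>i\<in>I. f i u)"
  using assms
  by (induction I rule: infinite_finite_induct) (auto intro: affine_form_const affine_form_add)

lemma sum_of_affine_squares_nonneg:
  assumes "sum_of_affine_squares p q"
  shows "0 \<le> q u"
proof -
  obtain fs where "q u = (\<Sum>f\<leftarrow>fs. (f u)\<^sup>2)"
    using assms unfolding sum_of_affine_squares_def by blast
  moreover have "0 \<le> (\<Sum>f\<leftarrow>fs. (f u)\<^sup>2)" by (induction fs) auto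
  ultimately show ?thesis by simp
qed

lemma sum_of_affine_squares_0: "sum_of_affine_squares p (\<lambda>u. 0)"
  unfolding sum_of_affine_squares_def by (rule exI[of _ "[]"]) simp

lemma sum_of_affine_squares_square:
  assumes "affine_form p f"
  shows "sum_of_affine_squares p (\<lambda>u. (f u)\<^sup>2)"
  unfolding sum_of_affine_squares_def by (rule exI[of _ "[f]"]) (simp add: assms)

lemma sum_of_affine_squares_add:
  assumes "sum_of_affine_squares p q" "sum_of_affine_squares p q'"
  shows "sum_of_affine_squares p (\<lambda>u. q u + q' u)"
proof -
  obtain fs where "\<forall>f\<in>set fs. affine_form p f" "\<forall>u. q u = (\<Sum>f\<leftarrow>fs. (f u)\<^sup>2)"
    using assms(1) unfolding sum_of_affine_squares_def by blast
  moreover obtain gs where "\<forall>f\<in>set gs. affine_form p f" "\<forall>u. q' u = (\<Sum>f\<leftarrow>gs. (f u)\<^sup>2)"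
    using assms(2) unfolding sum_of_affine_squares_def by blast
  ultimately show ?thesis
    unfolding sum_of_affine_squares_def by (intro exI[of _ "fs @ gs"]) auto
qed

lemma sum_of_affine_squares_scale:
  assumes "sum_of_affine_squares p q" "0 \<le> a"
  shows "sum_of_affine_squares p (\<lambda>u. a * q u)"
proof -
  obtain fs where fs: "\<forall>f\<in>set fs. affine_form p f" "\<forall>u. q u = (\<Sum>f\<leftarrow>fs. (f u)\<^sup>2)"
    using assms(1) unfolding sum_of_affine_squares_def by blast
  have "a * q u = (\<Sum>f\<leftarrow>map (\<lambda>f u. sqrt a * f u) fs. (f u)\<^sup>2)" for u
    using assms(2) fs(2) by (simp add: o_def power_mult_distrib sum_list_const_mult)
  moreover have "\<forall>f\<in>set (map (\<lambda>f u. sqrt a * f u) fs). affine_form p f"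
    using fs(1) by (auto intro: affine_form_scale)
  ultimately show ?thesis
    unfolding sum_of_affine_squares_def by blast
qed

lemma sum_of_affine_squares_sum:
  assumes "\<And>i. i \<in> I \<Longrightarrow> sum_of_affine_squares p (q i)"
  shows "sum_of_affine_squares p (\<lambda>u. \<Sum>i\<in>I. q i u)"
  using assms
  by (induction I rule: infinite_finite_induct)
     (auto intro: sum_of_affine_squares_0 sum_of_affine_squares_add)

lemma norm_power2_eq_sum: "(norm (x :: real ^ 'k))\<^sup>2 = (\<Sum>j\<in>UNIV. (x $ j)\<^sup>2)"
  by (simp add: norm_vec_def L2_set_def sum_nonneg)

lemma sum_of_affine_squares_norm:
  assumes "\<And>j. affine_form p (\<lambda>u. y u $ j)"
  shows "sum_of_affine_squares p (\<lambda>u. (norm (y u :: real ^ 'k))\<^sup>2)"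
  unfolding norm_power2_eq_sum
  by (intro sum_of_affine_squares_sum sum_of_affine_squares_square assms)

lemma soc_of_affine_forms:
  assumes fs: "\<forall>f\<in>set fs. affine_form p f" and "affine_form p h"
  shows "\<exists>C. \<forall>u. soc_holds p u C \<longleftrightarrow> sqrt (\<Sum>f\<leftarrow>fs. (f u)\<^sup>2) \<le> h u"
proof -
  obtain c d where h: "\<And>u. h u = (\<Sum>v\<in>vars p. c v * u v) + d"
    using assms(2) unfolding affine_form_def by blast
  obtain M q where f: "\<And>f u. f \<in> set fs \<Longrightarrow> f u = (\<Sum>v\<in>vars p. M f v * u v) + q f"
    using fs unfolding affine_form_def by metis
  have "L2_set (\<lambda>i. (\<Sum>v\<in>vars p. M (fs ! i) v * u v) + q (fs ! i)) {..<length fs}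
      = L2_set (\<lambda>i. (fs ! i) u) {..<length fs}" for u
    by (rule L2_set_cong) (use f in auto)
  also have "\<dots> u = sqrt (\<Sum>f\<leftarrow>fs. (f u)\<^sup>2)" for u
    by (simp add: L2_set_def sum_list_sum_nth atLeast0LessThan)
  finally show ?thesis
    by (intro exI[of _ "SOC (length fs) (\<lambda>i. M (fs ! i)) (\<lambda>i. q (fs ! i)) c d"]) (simp add: h)
qed

text \<open>Since \<open>4 g h = (g + h)\<^sup>2 - (g - h)\<^sup>2\<close>, the inequality \<open>q \<le> 2 g h\<close> says that the norm of the vector
  with the entry \<open>g - h\<close> and \<open>\<surd>2\<close> times each form whose square occurs in \<open>q\<close> is at most \<open>\<bar>g + h\<bar>\<close>. The cone drops the absolute
  value, which selects the branch where both factors are nonnegative.\<close>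

lemma soc_rotated_cone:
  assumes "sum_of_affine_squares p q" and g: "affine_form p g" and h: "affine_form p h"
  shows "\<exists>C. \<forall>u. soc_holds p u C \<longleftrightarrow> 0 \<le> g u \<and> 0 \<le> h u \<and> q u \<le> 2 * g u * h u"
proof -
  have "sum_of_affine_squares p (\<lambda>u. 2 * q u + (g u - h u)\<^sup>2)"
    by (intro sum_of_affine_squares_add sum_of_affine_squares_scale assms(1)
        sum_of_affine_squares_square affine_form_diff g h) simp
  then obtain fs where fs: "\<forall>f\<in>set fs. affine_form p f"
      "\<And>u. 2 * q u + (g u - h u)\<^sup>2 = (\<Sum>f\<leftarrow>fs. (f u)\<^sup>2)"
    unfolding sum_of_affine_squares_def by blast
  have q_nonneg: "0 \<le> q u" for u
    by (rule sum_of_affine_squares_nonneg[OF assms(1)])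
  obtain C where C: "\<And>u. soc_holds p u C \<longleftrightarrow> sqrt (2 * q u + (g u - h u)\<^sup>2) \<le> g u + h u"
    using soc_of_affine_forms[OF fs(1) affine_form_add[OF g h]] fs(2) by auto
  have "sqrt (2 * q u + (g u - h u)\<^sup>2) \<le> g u + h u \<longleftrightarrow>
      0 \<le> g u \<and> 0 \<le> h u \<and> q u \<le> 2 * g u * h u" for u
  proof
    assume L: "sqrt (2 * q u + (g u - h u)\<^sup>2) \<le> g u + h u"
    have "0 \<le> sqrt (2 * q u + (g u - h u)\<^sup>2)"
      using q_nonneg by simp
    with L have nonneg: "0 \<le> g u + h u" by linarith
    from L have "2 * q u + (g u - h u)\<^sup>2 \<le> (g u + h u)\<^sup>2"
      by (rule sqrt_le_D)
    then have le: "q u \<le> 2 * g u * h u"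
      by (simp add: power2_eq_square algebra_simps)
    then have "0 \<le> g u * h u" using q_nonneg[of u] by simp
    with nonneg have "0 \<le> g u \<and> 0 \<le> h u"
      by (auto simp: zero_le_mult_iff)
    with le show "0 \<le> g u \<and> 0 \<le> h u \<and> q u \<le> 2 * g u * h u" by simp
  next
    assume R: "0 \<le> g u \<and> 0 \<le> h u \<and> q u \<le> 2 * g u * h u"
    then have "2 * q u + (g u - h u)\<^sup>2 \<le> (g u + h u)\<^sup>2"
      by (simp add: power2_eq_square algebra_simps)
    with R show "sqrt (2 * q u + (g u - h u)\<^sup>2) \<le> g u + h u"
      by (intro real_le_lsqrt) auto
  qed
  with C show ?thesis by auto
qed

text \<open>This is the rotated cone with one factor equal to \<open>1\<close>; its condition \<open>0 \<le> g\<close> is implied by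
  \<open>0 \<le> q\<close>.\<close>

lemma soc_convex_quadratic:
  assumes "sum_of_affine_squares p q" and "affine_form p g"
  shows "\<exists>C. \<forall>u. soc_holds p u C \<longleftrightarrow> 1/2 * q u \<le> g u"
proof -
  obtain C where C: "\<And>u. soc_holds p u C \<longleftrightarrow> 0 \<le> (1::real) \<and> 0 \<le> g u \<and> q u \<le> 2 * 1 * g u"
    using soc_rotated_cone[OF assms(1) affine_form_const[of p 1] assms(2)] by auto
  have "1/2 * q u \<le> g u \<longleftrightarrow> 0 \<le> g u \<and> q u \<le> 2 * 1 * g u" for u
    using sum_of_affine_squares_nonneg[OF assms(1), of u] by auto
  then show ?thesis
    using C by (intro exI[of _ C]) simp
qed

text \<open>The weights \<open>\<xi>' / \<zeta>'\<close> and \<open>\<zeta>' / \<xi>'\<close> are positive in the scaled case, and in the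
  difference-of-convex case the concave part of the product has been linearized, which leaves one
  square.\<close>

lemma majorant_quadratic_form:
  assumes majorant: "(mj = majorant_scaled \<and> 0 < \<xi>' \<and> 0 < \<zeta>') \<or> mj = majorant_dc"
    and f: "affine_form p f" and g: "affine_form p g"
  shows "\<exists>q l. sum_of_affine_squares p q \<and> affine_form p l \<and>
    (\<forall>u. mj (f u) (g u) \<xi>' \<zeta>' = 1/2 * q u + l u)"
  using majorant
proof
  assume scaled: "mj = majorant_scaled \<and> 0 < \<xi>' \<and> 0 < \<zeta>'"
  show ?thesis
  proof (intro exI conjI allI)
    show "sum_of_affine_squares p (\<lambda>u. \<xi>' / \<zeta>' * (g u)\<^sup>2 + \<zeta>' / \<xi>' * (f u)\<^sup>2)"
      by (intro sum_of_affine_squares_add sum_of_affine_squares_scale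
          sum_of_affine_squares_square f g) (use scaled in auto)
    show "affine_form p (\<lambda>u. 0)" by (rule affine_form_const)
  qed (use scaled in \<open>simp add: majorant_scaled_def\<close>)
next
  assume dc: "mj = majorant_dc"
  show ?thesis
  proof (intro exI conjI allI)
    show "sum_of_affine_squares p (\<lambda>u. 1/2 * (f u + g u)\<^sup>2)"
      by (intro sum_of_affine_squares_scale sum_of_affine_squares_square affine_form_add f g) simp
    show "affine_form p (\<lambda>u. 1/4 * (\<xi>' - \<zeta>')\<^sup>2 - 1/2 * (\<xi>' - \<zeta>') * (f u - g u))"
      by (intro affine_form_diff affine_form_scale f g affine_form_const)
  qed (simp add: dc majorant_dc_def)
qed

section \<open>Conjugates of the loss and of the regularizers\<close>

lemma fenchel_conjugate_ge: "ereal (y \<bullet> x - f x) \<le> fenchel_conjugate f y"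
  unfolding fenchel_conjugate_def by (rule SUP_upper) simp

lemma fenchel_conjugate_eq_maximum:
  assumes "\<And>x. y \<bullet> x - f x \<le> y \<bullet> x\<^sub>0 - f x\<^sub>0"
  shows "fenchel_conjugate f y = ereal (y \<bullet> x\<^sub>0 - f x\<^sub>0)"
  by (rule antisym) (auto simp: fenchel_conjugate_def intro!: SUP_least SUP_upper assms)

text \<open>If \<open>f\<close> grows along the ray through \<open>z\<close> at a rate smaller than \<open>y \<bullet> z\<close>, then \<open>y \<bullet> x - f x\<close> is
  unbounded on that ray.\<close>

lemma fenchel_conjugate_eq_infinity:
  assumes growth: "\<And>c. 0 \<le> c \<Longrightarrow> f (c *\<^sub>R z) \<le> c * a + k" and slope: "a < y \<bullet> z"
  shows "fenchel_conjugate f y = \<infinity>"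
proof (rule ereal_top)
  fix B
  \<comment> \<open>The point on the ray at which the linear lower bound \<open>c * (y \<bullet> z - a) - k\<close> reaches \<open>B\<close>.\<close>
  define c where "c = max 0 ((B + k) / (y \<bullet> z - a))"
  have "(B + k) / (y \<bullet> z - a) \<le> c" by (simp add: c_def)
  then have "B + k \<le> c * (y \<bullet> z - a)"
    using slope by (simp add: pos_divide_le_eq)
  also have "\<dots> \<le> y \<bullet> (c *\<^sub>R z) - f (c *\<^sub>R z) + k"
    using growth[of c] by (simp add: c_def algebra_simps)
  finally have "ereal B \<le> ereal (y \<bullet> (c *\<^sub>R z) - f (c *\<^sub>R z))" by simp
  also have "\<dots> \<le> fenchel_conjugate f y" by (rule fenchel_conjugate_ge)
  finally show "ereal B \<le> fenchel_conjugate f y" .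
qed

lemma inner_transpose_mult: "(transpose A *v w) \<bullet> x = w \<bullet> (A *v x)"
  for A :: "real ^ 'n ^ 'm"
  by (simp add: dot_lmul_matrix)

text \<open>Completing the square in \<open>A x - b\<close> shows that the supremum is reached where \<open>A x = w + b\<close>. Full
  row rank is what makes this equation solvable.\<close>

lemma fenchel_conjugate_lsq_range:
  fixes A :: "real ^ 'n ^ 'm"
  assumes "rank A = CARD('m)"
  shows "fenchel_conjugate (lsq A b) (transpose A *v w) = ereal (1/2 * (norm w)\<^sup>2 + w \<bullet> b)"
proof -
  obtain x\<^sub>0 where x\<^sub>0: "A *v x\<^sub>0 = w + b"
    using assms unfolding full_rank_surjective by (metis surjD)
  have square: "(transpose A *v w) \<bullet> x - lsq A b x
      = 1/2 * (norm w)\<^sup>2 + w \<bullet> b - 1/2 * (norm (A *v x - b - w))\<^sup>2" for x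
    unfolding lsq_def inner_transpose_mult power2_norm_eq_inner
    by (simp add: inner_diff_left inner_diff_right inner_commute algebra_simps)
  have "fenchel_conjugate (lsq A b) (transpose A *v w)
      = ereal ((transpose A *v w) \<bullet> x\<^sub>0 - lsq A b x\<^sub>0)"
    by (rule fenchel_conjugate_eq_maximum) (unfold square, simp add: x\<^sub>0)
  then show ?thesis unfolding square by (simp add: x\<^sub>0)
qed

text \<open>The component \<open>z\<close> of \<open>y\<close> orthogonal to the range of \<open>A\<^sup>T\<close> lies in the kernel of \<open>A\<close>. The loss is
  constant along \<open>z\<close>, whereas \<open>y \<bullet> z = \<parallel>z\<parallel>\<^sup>2 > 0\<close>.\<close>

lemma fenchel_conjugate_lsq_not_range:
  fixes A :: "real ^ 'n ^ 'm"
  assumes "y \<notin> range ((*v) (transpose A))"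
  shows "fenchel_conjugate (lsq A b) y = \<infinity>"
proof -
  let ?S = "range ((*v) (transpose A))"
  have "span ?S = ?S"
    by (intro span_eq_iff[THEN iffD2] linear_subspace_image matrix_vector_mul_linear subspace_UNIV)
  then obtain a z where a: "a \<in> ?S" and z: "\<And>v. v \<in> ?S \<Longrightarrow> orthogonal z v" and y: "y = a + z"
    using orthogonal_subspace_decomp_exists[of ?S y] by metis
  have "(A *v z) \<bullet> (A *v z) = (transpose A *v (A *v z)) \<bullet> z"
    by (rule inner_transpose_mult[symmetric])
  also have "\<dots> = z \<bullet> (transpose A *v (A *v z))" by (rule inner_commute)
  also have "\<dots> = 0" using z[OF rangeI] unfolding orthogonal_def .
  finally have Az: "A *v z = 0" by simp
  have "a \<bullet> z = 0" using z[OF a] by (simp add: orthogonal_def inner_commute)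
  moreover have "z \<noteq> 0" using a y assms by auto
  ultimately have "0 < y \<bullet> z" by (simp add: y inner_add_left)
  moreover have "lsq A b (c *\<^sub>R z) \<le> c * 0 + 1/2 * (norm b)\<^sup>2" for c
    by (simp add: lsq_def Az matrix_vector_mult_scaleR)
  ultimately show ?thesis by (intro fenchel_conjugate_eq_infinity)
qed

text \<open>Inside the unit ball of the maximum norm, Hoelder's inequality bounds \<open>y \<bullet> x\<close> by the 1-norm of
  \<open>x\<close>. Outside it, the signed coordinate axis at an entry of largest modulus is a direction of
  unbounded growth.\<close>

lemma fenchel_conjugate_l1norm:
  fixes y :: "real ^ 'n"
  shows "fenchel_conjugate l1norm y = (if infnorm y \<le> 1 then 0 else \<infinity>)"
proof (cases "infnorm y \<le> 1")
  case True
  have upper: "y \<bullet> x - l1norm x \<le> y \<bullet> 0 - l1norm (0 :: real ^ 'n)" for x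
  proof -
    have "y $ j * x $ j \<le> \<bar>x $ j\<bar>" for j
    proof -
      have "\<bar>y $ j\<bar> * \<bar>x $ j\<bar> \<le> 1 * \<bar>x $ j\<bar>"
        using component_le_infnorm_cart[of y j] True by (intro mult_right_mono) auto
      then show ?thesis using abs_ge_self[of "y $ j * x $ j"] by (simp add: abs_mult)
    qed
    then have "y \<bullet> x \<le> l1norm x"
      unfolding inner_vec_def l1norm_def inner_real_def by (rule sum_mono)
    then show ?thesis by (simp add: l1norm_def)
  qed
  have "fenchel_conjugate l1norm y = ereal (y \<bullet> 0 - l1norm (0 :: real ^ 'n))"
    by (rule fenchel_conjugate_eq_maximum) (rule upper)
  with True show ?thesis by (simp add: l1norm_def)
next
  case False
  have "infnorm y = Max ((\<lambda>i. \<bar>y \<bullet> i\<bar>) ` Basis)" by (rule infnorm_Max)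
  also have "\<dots> \<in> (\<lambda>i. \<bar>y \<bullet> i\<bar>) ` Basis" by (intro Max_in) auto
  finally obtain j where j: "infnorm y = \<bar>y $ j\<bar>"
    by (auto simp: Basis_vec_def inner_axis)
  let ?z = "axis j (sgn (y $ j)) :: real ^ 'n"
  have growth: "l1norm (c *\<^sub>R ?z) \<le> c * 1 + 0" if "0 \<le> c" for c
  proof -
    have "l1norm (c *\<^sub>R ?z) = (\<Sum>i\<in>UNIV. if i = j then \<bar>c * sgn (y $ j)\<bar> else 0)"
      unfolding l1norm_def by (rule sum.cong) (auto simp: axis_def)
    then show ?thesis using that by (simp add: abs_mult abs_sgn_eq)
  qed
  have slope: "1 < y \<bullet> ?z"
    using False j by (simp add: inner_axis abs_sgn)
  have "fenchel_conjugate l1norm y = \<infinity>"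
    by (rule fenchel_conjugate_eq_infinity[OF growth slope])
  with False show ?thesis by simp
qed

lemma fenchel_conjugate_half_norm_power2:
  "fenchel_conjugate (\<lambda>x. 1/2 * (norm x)\<^sup>2) y = ereal (1/2 * (norm y)\<^sup>2)"
proof -
  have square: "y \<bullet> x - 1/2 * (norm x)\<^sup>2 = 1/2 * (norm y)\<^sup>2 - 1/2 * (norm (x - y))\<^sup>2" for x
    unfolding power2_norm_eq_inner
    by (simp add: inner_diff_left inner_diff_right inner_commute algebra_simps)
  have "fenchel_conjugate (\<lambda>x. 1/2 * (norm x)\<^sup>2) y = ereal (y \<bullet> y - 1/2 * (norm y)\<^sup>2)"
    by (rule fenchel_conjugate_eq_maximum) (unfold square, simp)
  then show ?thesis by (simp add: power2_norm_eq_inner)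
qed

lemma regularizer_1: "regularizer 1 = l1norm"
  by (auto simp: regularizer_def)

lemma regularizer_2: "regularizer 2 = (\<lambda>x. 1/2 * (norm x)\<^sup>2)"
  by (auto simp: regularizer_def)

lemma conjugate_perspective_l1norm:
  assumes "0 \<le> l"
  shows "conjugate_perspective (regularizer 1) l y = (if infnorm y \<le> l then 0 else \<infinity>)"
proof (cases "l = 0")
  case True
  moreover have "infnorm y \<le> 0 \<longleftrightarrow> y = 0"
    using infnorm_pos_lt[of y] by (simp add: not_less[symmetric])
  ultimately show ?thesis by (simp add: conjugate_perspective_def)
next
  case False
  then have "infnorm (y /\<^sub>R l) \<le> 1 \<longleftrightarrow> infnorm y \<le> l"
    using assms by (simp add: infnorm_mul field_simps)
  then show ?thesis
    using False assms
    by (simp add: conjugate_perspective_def regularizer_1 fenchel_conjugate_l1norm)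
qed

text \<open>The perspective is \<open>\<parallel>y\<parallel>\<^sup>2 / (2 l)\<close> for positive \<open>l\<close>. Multiplying out the denominator keeps the
  equivalence at \<open>l = 0\<close>: there the right-hand side forces \<open>y = 0\<close>, exactly as the closure of the
  perspective does.\<close>

lemma conjugate_perspective_half_norm_power2_le:
  assumes "0 \<le> l"
  shows "conjugate_perspective (regularizer 2) l y \<le> ereal s \<longleftrightarrow>
    0 \<le> s \<and> (norm y)\<^sup>2 \<le> 2 * l * s"
proof (cases "l = 0")
  case True
  then show ?thesis by (simp add: conjugate_perspective_def)
next
  case False
  then have l: "0 < l" using assms by simp
  have "norm (y /\<^sub>R l) = norm y / l"
    using l by (simp add: divide_inverse_commute)
  then have "l * (1/2 * (norm (y /\<^sub>R l))\<^sup>2) = (norm y)\<^sup>2 / (2 * l)"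
    using l by (simp add: power2_eq_square)
  then have "conjugate_perspective (regularizer 2) l y = ereal ((norm y)\<^sup>2 / (2 * l))"
    using l by (simp only: conjugate_perspective_def regularizer_2
        fenchel_conjugate_half_norm_power2 times_ereal.simps) simp
  then have "conjugate_perspective (regularizer 2) l y \<le> ereal s \<longleftrightarrow> (norm y)\<^sup>2 \<le> 2 * l * s"
    using l by (simp add: pos_divide_le_eq mult_ac)
  moreover have "0 \<le> s" if "(norm y)\<^sup>2 \<le> 2 * l * s"
  proof -
    have "0 \<le> 2 * l * s" using that by (rule order_trans[OF zero_le_power2])
    then show ?thesis using l by (simp add: zero_le_mult_iff)
  qed
  ultimately show ?thesis by auto
qed

section \<open>The conic program\<close>

text \<open>The conjugates never take the value \<open>- \<infinity>\<close>, so a penalty that is bounded above has only finite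
  summands, which gives \<open>w\<close> and the bound on \<open>\<rho>\<^sub>1\<close>. It suffices that \<open>s\<close> is an upper bound of the
  perspective term of \<open>\<rho>\<^sub>2\<close>, because the last inequality is increasing in \<open>s\<close>.\<close>

lemma penalty_constraint_iff:
  fixes A :: "real ^ 'n ^ 'm"
  assumes rank: "rank A = CARD('m)" and lam: "\<forall>i. 0 \<le> lam $ i"
  shows "penalty_F A b x lam \<rho> + ereal M \<le> 0 \<longleftrightarrow>
    (\<exists>w s. transpose A *v w + \<rho> $ 1 + \<rho> $ 2 = 0 \<and> infnorm (\<rho> $ 1) \<le> lam $ 1 \<and>
      0 \<le> s \<and> (norm (\<rho> $ 2))\<^sup>2 \<le> 2 * lam $ 2 * s \<and>
      lsq A b x + (1/2 * (norm w)\<^sup>2 + w \<bullet> b) + s + M \<le> 0)"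
    (is "?L \<longleftrightarrow> ?R")
proof -
  let ?l = "fenchel_conjugate (lsq A b) (- (\<rho> $ 1) - \<rho> $ 2)"
  let ?P1 = "conjugate_perspective (regularizer 1) (lam $ 1) (\<rho> $ 1)"
  let ?P2 = "conjugate_perspective (regularizer 2) (lam $ 2) (\<rho> $ 2)"
  have F: "penalty_F A b x lam \<rho> = ereal (lsq A b x) + ?l + (?P1 + ?P2)"
    by (simp add: penalty_F_def sum_2)
  have P1: "?P1 = (if infnorm (\<rho> $ 1) \<le> lam $ 1 then 0 else \<infinity>)"
    by (rule conjugate_perspective_l1norm) (use lam in blast)
  have P2: "?P2 \<le> ereal s \<longleftrightarrow> 0 \<le> s \<and> (norm (\<rho> $ 2))\<^sup>2 \<le> 2 * lam $ 2 * s" for s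
    by (rule conjugate_perspective_half_norm_power2_le) (use lam in blast)
  have range_iff: "v + \<rho> $ 1 + \<rho> $ 2 = 0 \<longleftrightarrow> - (\<rho> $ 1) - \<rho> $ 2 = v" for v
  proof -
    have "v + \<rho> $ 1 + \<rho> $ 2 = 0 \<longleftrightarrow> v = - (\<rho> $ 1 + \<rho> $ 2)"
      by (simp only: eq_neg_iff_add_eq_0 add.assoc)
    also have "- (\<rho> $ 1 + \<rho> $ 2) = - (\<rho> $ 1) - \<rho> $ 2" by simp
    finally show ?thesis by auto
  qed
  have l_range: "?l = ereal (1/2 * (norm w)\<^sup>2 + w \<bullet> b)"
    if "transpose A *v w + \<rho> $ 1 + \<rho> $ 2 = 0" for w
    using that fenchel_conjugate_lsq_range[OF rank] unfolding range_iff by simp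
  have P2_finite: "?P2 \<noteq> - \<infinity>"
  proof
    assume "?P2 = - \<infinity>"
    then have "?P2 \<le> ereal (- 1)" by simp
    then show False unfolding P2 by simp
  qed
  show ?thesis
  proof
    assume ?L
    then have fin: "ereal (lsq A b x) + ?l + (?P1 + ?P2) \<noteq> \<infinity>"
      unfolding F by auto
    have "?l \<noteq> - \<infinity>"
      using fenchel_conjugate_ge[of "- (\<rho> $ 1) - \<rho> $ 2" 0 "lsq A b"] by auto
    with fin P1 P2_finite have "?l \<noteq> \<infinity>" "?P1 \<noteq> \<infinity>" "?P2 \<noteq> \<infinity>" by auto
    then have "- (\<rho> $ 1) - \<rho> $ 2 \<in> range ((*v) (transpose A))"
      using fenchel_conjugate_lsq_not_range by blast
    then obtain w where "- (\<rho> $ 1) - \<rho> $ 2 = transpose A *v w" by blast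
    then have w: "transpose A *v w + \<rho> $ 1 + \<rho> $ 2 = 0"
      unfolding range_iff .
    obtain s where s: "?P2 = ereal s"
      using P2_finite \<open>?P2 \<noteq> \<infinity>\<close> by (cases ?P2) auto
    have le: "infnorm (\<rho> $ 1) \<le> lam $ 1" using P1 \<open>?P1 \<noteq> \<infinity>\<close> by presburger
    have "lsq A b x + (1/2 * (norm w)\<^sup>2 + w \<bullet> b) + s + M \<le> 0"
      using \<open>?L\<close> unfolding F l_range[OF w] s P1 if_P[OF le] by (simp add: zero_ereal_def)
    then show ?R using w le P2[of s] s by auto
  next
    assume ?R
    then obtain w s where w: "transpose A *v w + \<rho> $ 1 + \<rho> $ 2 = 0"
      and le: "infnorm (\<rho> $ 1) \<le> lam $ 1" and s: "?P2 \<le> ereal s"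
      and M: "lsq A b x + (1/2 * (norm w)\<^sup>2 + w \<bullet> b) + s + M \<le> 0"
      unfolding P2 by blast
    have "penalty_F A b x lam \<rho> + ereal M \<le>
        ereal (lsq A b x) + ereal (1/2 * (norm w)\<^sup>2 + w \<bullet> b) + (0 + ereal s) + ereal M"
      unfolding F l_range[OF w] P1 if_P[OF le] by (intro add_mono order_refl s)
    also have "\<dots> \<le> 0" using M by (simp add: zero_ereal_def)
    finally show ?L .
  qed
qed

theorem proposition3p2:
  fixes A_tr :: "real ^ 'n ^ 'm" and b_tr :: "real ^ 'm"
    and A_val :: "real ^ 'n ^ 'v" and b_val :: "real ^ 'v"
    and lamk rk :: "real ^ 2"
    and mj :: "real \<Rightarrow> real \<Rightarrow> real \<Rightarrow> real \<Rightarrow> real"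
  assumes full_row_rank: "rank A_tr = CARD('m)"
    and majorant: "(mj = majorant_scaled \<and> (\<forall>i. 0 < lamk $ i \<and> 0 < rk $ i)) \<or> mj = majorant_dc"
  shows "\<exists>(p :: nat) (socs :: ('n, 'm) soc list).
    \<forall>(x :: real ^ 'n) (lam :: real ^ 2) (\<rho> :: real ^ 'n ^ 2) (r :: real ^ 2) (t :: real).
      subproblem_feasible A_tr b_tr mj lamk rk x lam \<rho> r \<and> lsq A_val b_val x \<le> t \<longleftrightarrow>
      (\<exists>(w :: real ^ 'm) (s :: nat \<Rightarrow> real).
         transpose A_tr *v w + \<rho> $ 1 + \<rho> $ 2 = 0 \<and>
         l1norm x \<le> r $ 1 \<and>
         infnorm (\<rho> $ 1) \<le> lam $ 1 \<and>
         (\<forall>C \<in> set socs. soc_holds p (decision_vector x lam \<rho> r t w s) C))"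
proof -
  \<comment> \<open>The single auxiliary variable \<open>VarAux 0\<close> bounds the perspective term of \<open>\<rho>\<^sub>2\<close>. The
    simplifier would turn the number \<open>1\<close> of auxiliary variables into \<open>Suc 0\<close>, which the facts
    stated for \<open>1\<close> do not match.\<close>
  note One_nat_def [simp del]
  have var: "affine_form 1 (\<lambda>u. u v)" if "\<And>k. v = VarAux k \<Longrightarrow> k = 0" for v :: "('n, 'm) var"
    by (rule affine_form_var) (use that in \<open>simp add: mem_vars_iff\<close>)
  \<comment> \<open>The vectors \<open>x\<close>, \<open>\<rho>\<^sub>i\<close> and \<open>w\<close> read off from a decision vector.\<close>
  define X :: "(('n, 'm) var \<Rightarrow> real) \<Rightarrow> real ^ 'n" where "X = (\<lambda>u. \<chi> j. u (VarX j))"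
  define R :: "2 \<Rightarrow> (('n, 'm) var \<Rightarrow> real) \<Rightarrow> real ^ 'n" where "R = (\<lambda>i u. \<chi> j. u (VarRho i j))"
  define W :: "(('n, 'm) var \<Rightarrow> real) \<Rightarrow> real ^ 'm" where "W = (\<lambda>u. \<chi> j. u (VarW j))"

  have residual: "sum_of_affine_squares 1 (\<lambda>u. (norm (A *v X u - b))\<^sup>2)"
    for A :: "real ^ 'n ^ 'k" and b
    unfolding X_def
    by (rule sum_of_affine_squares_norm)
       (auto simp: matrix_vector_mult_def
          intro!: affine_form_diff affine_form_sum affine_form_scale affine_form_const var)
  have X: "sum_of_affine_squares 1 (\<lambda>u. (norm (X u))\<^sup>2)"
    unfolding X_def by (rule sum_of_affine_squares_norm) (auto intro: var)
  have R: "sum_of_affine_squares 1 (\<lambda>u. (norm (R 2 u))\<^sup>2)"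
    unfolding R_def by (rule sum_of_affine_squares_norm) (auto intro: var)
  have W: "sum_of_affine_squares 1 (\<lambda>u. (norm (W u))\<^sup>2)"
    unfolding W_def by (rule sum_of_affine_squares_norm) (auto intro: var)
  have Wb: "affine_form 1 (\<lambda>u. b_tr \<bullet> W u)"
    unfolding W_def by (auto simp: inner_vec_def intro!: affine_form_sum affine_form_scale var)

  have "\<exists>q l. sum_of_affine_squares 1 q \<and> affine_form 1 l \<and>
      (\<forall>u :: ('n, 'm) var \<Rightarrow> real.
        mj (u (VarLam i)) (u (VarR i)) (lamk $ i) (rk $ i) = 1/2 * q u + l u)" for i
    by (rule majorant_quadratic_form) (use majorant in \<open>auto intro: var\<close>)
  then have "\<forall>i. \<exists>q l. sum_of_affine_squares 1 q \<and> affine_form 1 l \<and>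
      (\<forall>u :: ('n, 'm) var \<Rightarrow> real.
        mj (u (VarLam i)) (u (VarR i)) (lamk $ i) (rk $ i) = 1/2 * q u + l u)"
    by blast
  then obtain q l where q: "\<And>i. sum_of_affine_squares 1 (q i)" and l: "\<And>i. affine_form 1 (l i)"
    and mj: "\<And>i (u :: ('n, 'm) var \<Rightarrow> real).
      mj (u (VarLam i)) (u (VarR i)) (lamk $ i) (rk $ i) = 1/2 * q i u + l i u"
    unfolding choice_iff by blast

  obtain C_ridge where C_ridge: "\<And>u. soc_holds 1 u C_ridge \<longleftrightarrow> 1/2 * (norm (X u))\<^sup>2 \<le> u (VarR 2)"
    using soc_convex_quadratic[OF X, of "\<lambda>u. u (VarR 2)"] by (auto intro: var)
  obtain C_val where C_val: "\<And>u. soc_holds 1 u C_val \<longleftrightarrow>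
      1/2 * (norm (A_val *v X u - b_val))\<^sup>2 \<le> u VarT"
    using soc_convex_quadratic[OF residual[of A_val b_val], of "\<lambda>u. u VarT"]
    by (auto intro: var)
  obtain C_dual where C_dual: "\<And>u. soc_holds 1 u C_dual \<longleftrightarrow>
      0 \<le> u (VarLam 2) \<and> 0 \<le> u (VarAux 0) \<and>
      (norm (R 2 u))\<^sup>2 \<le> 2 * u (VarLam 2) * u (VarAux 0)"
    using soc_rotated_cone[OF R, of "\<lambda>u. u (VarLam 2)" "\<lambda>u. u (VarAux 0)"]
    by (auto intro: var)
  \<comment> \<open>The penalty constraint, with \<open>F\<close> and the majorants replaced by their closed forms and all
    affine terms moved to the right.\<close>
  have "\<exists>C. \<forall>u. soc_holds 1 u C \<longleftrightarrow>
      1/2 * ((norm (A_tr *v X u - b_tr))\<^sup>2 + (norm (W u))\<^sup>2 + (\<Sum>i\<in>UNIV. q i u))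
        \<le> (- 1) * (b_tr \<bullet> W u) - u (VarAux 0) - (\<Sum>i\<in>UNIV. l i u)"
    by (intro soc_convex_quadratic sum_of_affine_squares_add residual W
        sum_of_affine_squares_sum q affine_form_diff affine_form_scale Wb var
        affine_form_sum l) simp
  then obtain C_gap where C_gap: "\<And>u. soc_holds 1 u C_gap \<longleftrightarrow>
      1/2 * ((norm (A_tr *v X u - b_tr))\<^sup>2 + (norm (W u))\<^sup>2 + (\<Sum>i\<in>UNIV. q i u))
        \<le> (- 1) * (b_tr \<bullet> W u) - u (VarAux 0) - (\<Sum>i\<in>UNIV. l i u)"
    by blast

  show ?thesis
  proof (intro exI[of _ 1] exI[of _ "[C_ridge, C_val, C_dual, C_gap]"] allI)
    fix x :: "real ^ 'n" and lam r :: "real ^ 2" and \<rho> :: "real ^ 'n ^ 2" and t :: real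
    let ?M = "\<Sum>i\<in>UNIV. mj (lam $ i) (r $ i) (lamk $ i) (rk $ i)"
    have socs: "(\<forall>C \<in> set [C_ridge, C_val, C_dual, C_gap].
          soc_holds 1 (decision_vector x lam \<rho> r t w s) C) \<longleftrightarrow>
        1/2 * (norm x)\<^sup>2 \<le> r $ 2 \<and> lsq A_val b_val x \<le> t \<and>
        (0 \<le> lam $ 2 \<and> 0 \<le> s 0 \<and> (norm (\<rho> $ 2))\<^sup>2 \<le> 2 * lam $ 2 * s 0) \<and>
        lsq A_tr b_tr x + (1/2 * (norm w)\<^sup>2 + w \<bullet> b_tr) + s 0 + ?M \<le> 0"
      for w :: "real ^ 'm" and s :: "nat \<Rightarrow> real"
    proof -
      let ?u = "decision_vector x lam \<rho> r t w s"
      have "X ?u = x" "R 2 ?u = \<rho> $ 2" "W ?u = w"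
        by (simp_all add: X_def R_def W_def)
      moreover have "?M = 1/2 * (\<Sum>i\<in>UNIV. q i ?u) + (\<Sum>i\<in>UNIV. l i ?u)"
        using mj[of ?u] by (simp add: sum.distrib sum_distrib_left)
      ultimately show ?thesis
        by (auto simp: C_ridge C_val C_dual C_gap lsq_def inner_commute algebra_simps)
    qed
    \<comment> \<open>The conic program has no explicit constraint \<open>0 \<le> lam\<close>: the norm bound implies it for the
      first component, the rotated cone for the second.\<close>
    have lam_nonneg: "\<forall>i. 0 \<le> lam $ i" if "infnorm (\<rho> $ 1) \<le> lam $ 1" "0 \<le> lam $ 2"
      using that infnorm_pos_le[of "\<rho> $ 1"] by (metis exhaust_2 order_trans)
    show "subproblem_feasible A_tr b_tr mj lamk rk x lam \<rho> r \<and> lsq A_val b_val x \<le> t \<longleftrightarrow>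
      (\<exists>(w :: real ^ 'm) (s :: nat \<Rightarrow> real).
         transpose A_tr *v w + \<rho> $ 1 + \<rho> $ 2 = 0 \<and>
         l1norm x \<le> r $ 1 \<and>
         infnorm (\<rho> $ 1) \<le> lam $ 1 \<and>
         (\<forall>C \<in> set [C_ridge, C_val, C_dual, C_gap].
           soc_holds 1 (decision_vector x lam \<rho> r t w s) C))" (is "?L \<longleftrightarrow> ?R")
    proof
      assume L: ?L
      then have lam: "\<forall>i. 0 \<le> lam $ i" and "penalty_F A_tr b_tr x lam \<rho> + ereal ?M \<le> 0"
        by (simp_all add: subproblem_feasible_def)
      then obtain w s where
        "transpose A_tr *v w + \<rho> $ 1 + \<rho> $ 2 = 0" "infnorm (\<rho> $ 1) \<le> lam $ 1"
        "0 \<le> s" "(norm (\<rho> $ 2))\<^sup>2 \<le> 2 * lam $ 2 * s"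
        "lsq A_tr b_tr x + (1/2 * (norm w)\<^sup>2 + w \<bullet> b_tr) + s + ?M \<le> 0"
        unfolding penalty_constraint_iff[OF full_row_rank lam] by blast
      then show ?R
        unfolding socs using L lam
        by (intro exI[of _ w] exI[of _ "\<lambda>_. s"]) (simp add: subproblem_feasible_def)
    next
      assume ?R
      then obtain w and s :: "nat \<Rightarrow> real" where R: "transpose A_tr *v w + \<rho> $ 1 + \<rho> $ 2 = 0" "l1norm x \<le> r $ 1"
        "infnorm (\<rho> $ 1) \<le> lam $ 1" "1/2 * (norm x)\<^sup>2 \<le> r $ 2" "lsq A_val b_val x \<le> t"
        "0 \<le> lam $ 2" "0 \<le> s 0" "(norm (\<rho> $ 2))\<^sup>2 \<le> 2 * lam $ 2 * s 0"
        "lsq A_tr b_tr x + (1/2 * (norm w)\<^sup>2 + w \<bullet> b_tr) + s 0 + ?M \<le> 0"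
        unfolding socs by blast
      then have lam: "\<forall>i. 0 \<le> lam $ i" by (intro lam_nonneg)
      have "penalty_F A_tr b_tr x lam \<rho> + ereal ?M \<le> 0"
        unfolding penalty_constraint_iff[OF full_row_rank lam] using R by blast
      with R lam show ?L by (simp add: subproblem_feasible_def)
    qed
  qed
qed

end
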